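(* Let $m>0$ and let $\vec p=(p_0,p_-,p_+,p_3)=(m,0,0,0)$. Then the images of the $q$-Pauli-Lubanski vector under $\hat\chi_{\vec p}:\mathcal{A}\to\mathcal{H}$ are $$\hat\chi_{\vec p}(W_0)=\lambda^{-1}(W-1)m,\quad\hat\chi_{\vec p}(W_-)=J_-K^{-1}m,\quad\hat\chi_{\vec p}(W_+)=J_+K^{-1}m,\quad\hat\chi_{\vec p}(W_3)=\lambda^{-1}(W-K^{-1})m,$$ and the massive $q$-little algebra $\mathcal{K}_{(m,0,0,0)}$, i.e. the unital subalgebra of $\mathcal{H}$ generated by these elements together with the inverse $K$ of $K^{-1}$, is $$\mathcal{K}_{(m,0,0,0)}=\mathcal{U}_q(\mathrm{su}_2).$$
   Context: Conventions: $q>1$ is real, $\lambda=q-q^{-1}$, $[j]=(q^j-q^{-j})/(q-q^{-1})$, so $[2]=q+q^{-1}$. Indices $\mu,\nu$ run through $\{0,-,+,3\}$, $A$ through $\{-,+,3\}$; repeated indices are summed. Sweedler notation $\Delta(h)=h_{(1)}\otimes h_{(2)}$. $\mathcal{U}_q(\mathrm{su}_2)$: generators $E,F,K^{\pm1}$ with $KEK^{-1}=q^2E$, $KFK^{-1}=q^{-2}F$, $[E,F]=\lambda^{-1}(K-K^{-1})$; $\Delta E=E\otimes K+1\otimes E$, $\Delta F=F\otimes1+K^{-1}\otimes F$, $\Delta K=K\otimes K$; $S(E)=-EK^{-1}$, $S(F)=-KF$, $S(K)=K^{-1}$. Put $J_-=q[2]^{-1/2}KF$, $J_3=[2]^{-1}(q^{-1}EF-qFE)$,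 $J_+=-[2]^{-1/2}E$, $W=K-\lambda J_3$ (without index; central in $\mathcal{U}_q(\mathrm{su}_2)$). $SU_q(2)^{\mathrm{op}}$: generators $a,b,c,d$ with $ba=qab$, $ca=qac$, $db=qbd$, $dc=qcd$, $bc=cb$, $da-ad=\lambda bc$, $da-qbc=1$; matrix coproduct; $S(a)=d$, $S(b)=-qb$, $S(c)=-q^{-1}c$, $S(d)=a$. $q$-Lorentz algebra $\mathcal{H}$: the Hopf algebra generated by the Hopf subalgebras $\mathcal{U}_q(\mathrm{su}_2)$ and $SU_q(2)^{\mathrm{op}}$ with cross relations $$\begin{pmatrix} a&b \\ c&d \end{pmatrix}E=\begin{pmatrix} qEa-q^{3/2}b&q^{-1}Eb \\ {} qEc+q^{3/2}Ka-q^{3/2}d&q^{-1}Ed+q^{-1/2}Kb \end{pmatrix},$$ $$\begin{pmatrix} a&b \\ c&d \end{pmatrix}F=\begin{pmatrix} qFa+q^{-1/2}c&qFb-q^{-1/2}K^{-1}a+q^{-1/2}d \\ {} q^{-1}Fc&q^{-1}Fd-q^{-5/2}K^{-1}c \end{pmatrix},\quad\begin{pmatrix} a&b \\ c&d \end{pmatrix}K=K\begin{pmatrix} a&q^{-2}b \\ {} q^2c&d \end{pmatrix}$$ (a Drinfeld double; $\mathcal{U}_q(\mathrm{su}_2)\otimes SU_q(2)^{\mathrm{op}}\to\mathcal{H}$, the multiplication map, is a linear isomorphism). $q$-Minkowski algebra $\mathcal{X}$: generators $P_0,P_-,P_+,P_3$ with $P_0P_A=P_AP_0$, $q^{-1}P_-P_3-qP_3P_-=-\lambda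 P_0P_-$, $q^{-1}P_3P_+-qP_+P_3=-\lambda P_0P_+$, $P_-P_+-P_+P_--\lambda P_3^2=-\lambda P_0P_3$. It is a left $\mathcal{H}$-module algebra, with $P_\mu$ transforming in the 4-vector representation, and $\mathcal{A}=\mathcal{X}\rtimes\mathcal{H}$ is the semidirect product ($q$-Poincaré algebra) with cross relations $hx=(h_{(1)}\triangleright x)h_{(2)}$. Every $y\in\mathcal{A}$ can be uniquely written as $y=\sum_ih_ix_i$ in $\mathcal{H}\cdot\mathcal{X}$ (i.e. multiplication $\mathcal{H}\otimes\mathcal{X}\to\mathcal{A}$ is a linear isomorphism). The $q$-Pauli-Lubanski vector is $W_\nu=\lambda^{-1}S^2\bigl[(L^\Lambda_{\mathrm{I}-})^\mu{}_\nu-(L^\Lambda_{\mathrm{I}+})^\mu{}_\nu\bigr]P_\mu$, where (row $\mu$, column $\nu$, basis $(0,-,+,3)$) $$L^\Lambda_{\mathrm{I}+}=\begin{pmatrix} 1&0&0&0 \\ 0&a^2&b^2&q^{1/2}[2]^{1/2}ab \\ 0&c^2&d^2&q^{1/2}[2]^{1/2}cd \\ 0&q^{1/2}[2]^{1/2}ac&q^{1/2}[2]^{1/2}bd&1+[2]bc \end{pmatrix},$$ $$L^\Lambda_{\mathrm{I}-}=\begin{pmatrix} W&\lambda K^{-1}J_-&\lambda K^{-1}J_+&W-K^{-1} \\ -q^{-1}\lambda J_+&1&0&-q^{-1}\lambda J_+ \\ -q\lambda J_-&0&1&-q\lambda J_- \\ \lambda J_3&-\lambda K^{-1}J_-&-\lambda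 K^{-1}J_+&\lambda J_3+K^{-1} \end{pmatrix}.$$ For a tuple $\vec p=(p_\mu)$ such that $P_\mu\mapsto p_\mu$ extends to an algebra homomorphism $\chi_{\vec p}:\mathcal{X}\to\mathbb{C}$ (this holds for $(m,0,0,0)$), define the linear map $\hat\chi_{\vec p}:\mathcal{A}\to\mathcal{H}$ by $\hat\chi_{\vec p}(\sum_ih_ix_i)=\sum_ih_i\chi_{\vec p}(x_i)$. The little algebra is the unital algebra generated by the elements $\hat\chi_{\vec p}(W_\mu)$; in the massive case the paper adds $K$, the inverse of the element $K^{-1}$ of that algebra, to the generators. *)

theory Defs
  imports Complex_Main "HOL-Library.Poly_Mapping" "HOL-Algebra.Generated_Rings"
    "HOL-Algebra.Algebraic_Closure_Type"
begin

section \<open>Free complex algebras and presented algebras\<close>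

datatype 'g ncword = Word (letters: "'g list")

instantiation ncword :: (type) monoid_add
begin
definition zero_ncword :: "'a ncword" where "zero_ncword = Word []"
definition plus_ncword :: "'a ncword \<Rightarrow> 'a ncword \<Rightarrow> 'a ncword" where
  "plus_ncword u v = Word (letters u @ letters v)"
instance
  by standard (simp_all add: zero_ncword_def plus_ncword_def)
end

text \<open>The word monoid is written additively, so that the convolution product of
  \<^theory>\<open>HOL-Library.Poly_Mapping\<close> is the product of noncommutative polynomials.\<close>

type_synonym 'g ncpoly = "'g ncword \<Rightarrow>\<^sub>0 complex"

definition scal :: "complex \<Rightarrow> 'g ncpoly" where
  "scal c = Poly_Mapping.single 0 c"

definition wmono :: "'g list \<Rightarrow> 'g ncpoly" where
  "wmono w = Poly_Mapping.single (Word w) 1"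

definition gen :: "'g \<Rightarrow> 'g ncpoly" where
  "gen g = wmono [g]"

definition rscale :: "real \<Rightarrow> 'g ncpoly \<Rightarrow> 'g ncpoly" (infixr \<open>\<cdot>\<close> 75) where
  "r \<cdot> x = scal (complex_of_real r) * x"

text \<open>The algebra homomorphism (resp. antihomomorphism) out of the free algebra with prescribed
  values \<open>\<phi>\<close> on the generators; \<open>s\<close> embeds the scalars in the target.\<close>

definition lift :: "(complex \<Rightarrow> 'r) \<Rightarrow> ('g \<Rightarrow> 'r) \<Rightarrow> 'g ncpoly \<Rightarrow> 'r::ring_1" where
  "lift s \<phi> f = (\<Sum>w\<in>Poly_Mapping.keys f.
      s (Poly_Mapping.lookup f w) * prod_list (map \<phi> (letters w)))"

definition anti_lift :: "(complex \<Rightarrow> 'r) \<Rightarrow> ('g \<Rightarrow> 'r) \<Rightarrow> 'g ncpoly \<Rightarrow> 'r::ring_1" where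
  "anti_lift s \<phi> f = (\<Sum>w\<in>Poly_Mapping.keys f.
      s (Poly_Mapping.lookup f w) * prod_list (map \<phi> (rev (letters w))))"

abbreviation free_alg :: "'g ncpoly ring" where
  "free_alg \<equiv> ring_of_type_algebra"

text \<open>A relation \<open>l = r\<close> is represented by the element \<open>l - r\<close>.\<close>

definition rel_ideal :: "'g ncpoly set \<Rightarrow> 'g ncpoly set" where
  "rel_ideal R = Idl\<^bsub>free_alg\<^esub> R"

definition presented :: "'g ncpoly set \<Rightarrow> 'g ncpoly set ring" where
  "presented R = free_alg Quot rel_ideal R"

definition cls :: "'g ncpoly set \<Rightarrow> 'g ncpoly \<Rightarrow> 'g ncpoly set" where
  "cls R x = rel_ideal R +>\<^bsub>free_alg\<^esub> x"

text \<open>The map on a quotient induced by a map that is constant on each coset.\<close>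

definition induced :: "('x \<Rightarrow> 'y) \<Rightarrow> 'x set \<Rightarrow> 'y" where
  "induced f C = the_elem (f ` C)"

section \<open>q-numbers and index set\<close>

definition qlam :: "real \<Rightarrow> real" where
  "qlam q = q - 1 / q"

definition qnum :: "real \<Rightarrow> nat \<Rightarrow> real" where
  "qnum q j = (q ^ j - (1 / q) ^ j) / (q - 1 / q)"

datatype idx = I0 | IM | IP | I3

instance idx :: finite
proof
  have "(UNIV :: idx set) = {I0, IM, IP, I3}"
    using idx.exhaust by auto
  then show "finite (UNIV :: idx set)"
    by (metis finite.emptyI finite_insert)
qed

fun pos :: "idx \<Rightarrow> nat" where
  "pos I0 = 0" | "pos IM = 1" | "pos IP = 2" | "pos I3 = 3"

text \<open>\<open>mat rows \<mu> \<nu>\<close> is the entry in row \<open>\<mu>\<close> and column \<open>\<nu>\<close>, the basis being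
  ordered as \<open>(0, -, +, 3)\<close>.\<close>

definition mat :: "'e list list \<Rightarrow> idx \<Rightarrow> idx \<Rightarrow> 'e" where
  "mat rows \<mu> \<nu> = rows ! pos \<mu> ! pos \<nu>"

section \<open>The q-Lorentz algebra\<close>

datatype lgen = GE | GF | GK | GKi | Ga | Gb | Gc | Gd

abbreviation eE :: "lgen ncpoly" where "eE \<equiv> gen GE"
abbreviation eF :: "lgen ncpoly" where "eF \<equiv> gen GF"
abbreviation eK :: "lgen ncpoly" where "eK \<equiv> gen GK"
abbreviation eKi :: "lgen ncpoly" where "eKi \<equiv> gen GKi"
abbreviation ea :: "lgen ncpoly" where "ea \<equiv> gen Ga"
abbreviation eb :: "lgen ncpoly" where "eb \<equiv> gen Gb"
abbreviation ec :: "lgen ncpoly" where "ec \<equiv> gen Gc"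
abbreviation ed :: "lgen ncpoly" where "ed \<equiv> gen Gd"

definition rels_U :: "real \<Rightarrow> lgen ncpoly set" where
  "rels_U q =
    {eK * eKi - 1,
     eKi * eK - 1,
     eK * eE * eKi - q\<^sup>2 \<cdot> eE,
     eK * eF * eKi - (1 / q\<^sup>2) \<cdot> eF,
     eE * eF - eF * eE - (1 / qlam q) \<cdot> (eK - eKi)}"

definition rels_SU :: "real \<Rightarrow> lgen ncpoly set" where
  "rels_SU q =
    {eb * ea - q \<cdot> (ea * eb),
     ec * ea - q \<cdot> (ea * ec),
     ed * eb - q \<cdot> (eb * ed),
     ed * ec - q \<cdot> (ec * ed),
     eb * ec - ec * eb,
     ed * ea - ea * ed - qlam q \<cdot> (eb * ec),
     ed * ea - q \<cdot> (eb * ec) - 1}"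

definition rels_cross :: "real \<Rightarrow> lgen ncpoly set" where
  "rels_cross q =
    {ea * eE - (q \<cdot> (eE * ea) - (q powr (3/2)) \<cdot> eb),
     eb * eE - (1 / q) \<cdot> (eE * eb),
     ec * eE - (q \<cdot> (eE * ec) + (q powr (3/2)) \<cdot> (eK * ea) - (q powr (3/2)) \<cdot> ed),
     ed * eE - ((1 / q) \<cdot> (eE * ed) + (q powr (-1/2)) \<cdot> (eK * eb)),
     ea * eF - (q \<cdot> (eF * ea) + (q powr (-1/2)) \<cdot> ec),
     eb * eF - (q \<cdot> (eF * eb) - (q powr (-1/2)) \<cdot> (eKi * ea) + (q powr (-1/2)) \<cdot> ed),
     ec * eF - (1 / q) \<cdot> (eF * ec),
     ed * eF - ((1 / q) \<cdot> (eF * ed) - (q powr (-5/2)) \<cdot> (eKi * ec)),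
     ea * eK - eK * ea,
     eb * eK - (1 / q\<^sup>2) \<cdot> (eK * eb),
     ec * eK - q\<^sup>2 \<cdot> (eK * ec),
     ed * eK - eK * ed}"

definition rels_H :: "real \<Rightarrow> lgen ncpoly set" where
  "rels_H q = rels_U q \<union> rels_SU q \<union> rels_cross q"

definition HA :: "real \<Rightarrow> lgen ncpoly set ring" where
  "HA q = presented (rels_H q)"

abbreviation clsH :: "real \<Rightarrow> lgen ncpoly \<Rightarrow> lgen ncpoly set" where
  "clsH q \<equiv> cls (rels_H q)"

text \<open>A unital complex subalgebra is a subring containing the scalars.\<close>

definition subalg :: "real \<Rightarrow> lgen ncpoly set set \<Rightarrow> lgen ncpoly set set" where
  "subalg q G = generate_ring (HA q) (range (\<lambda>c. clsH q (scal c)) \<union> G)"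

text \<open>\<open>U\<^sub>q(su\<^sub>2)\<close> as a Hopf subalgebra of the q-Lorentz algebra.\<close>

definition Uq_su2 :: "real \<Rightarrow> lgen ncpoly set set" where
  "Uq_su2 q = subalg q {clsH q eE, clsH q eF, clsH q eK, clsH q eKi}"

fun antipode_gen :: "real \<Rightarrow> lgen \<Rightarrow> lgen ncpoly" where
  "antipode_gen q GE = - (eE * eKi)"
| "antipode_gen q GF = - (eK * eF)"
| "antipode_gen q GK = eKi"
| "antipode_gen q GKi = eK"
| "antipode_gen q Ga = ed"
| "antipode_gen q Gb = (- q) \<cdot> eb"
| "antipode_gen q Gc = (- 1 / q) \<cdot> ec"
| "antipode_gen q Gd = ea"

definition antipode :: "real \<Rightarrow> lgen ncpoly set \<Rightarrow> lgen ncpoly set" where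
  "antipode q = induced (\<lambda>x. clsH q (anti_lift scal (antipode_gen q) x))"

text \<open>The coproduct of a generator; a pair of lists \<open>(u, v)\<close> stands for the tensor \<open>u \<otimes> v\<close> of
  the products of \<open>u\<close> and of \<open>v\<close>.\<close>

fun coprod :: "lgen \<Rightarrow> (lgen list \<times> lgen list) list" where
  "coprod GE = [([GE], [GK]), ([], [GE])]"
| "coprod GF = [([GF], []), ([GKi], [GF])]"
| "coprod GK = [([GK], [GK])]"
| "coprod GKi = [([GKi], [GKi])]"
| "coprod Ga = [([Ga], [Ga]), ([Gb], [Gc])]"
| "coprod Gb = [([Ga], [Gb]), ([Gb], [Gd])]"
| "coprod Gc = [([Gc], [Ga]), ([Gd], [Gc])]"
| "coprod Gd = [([Gc], [Gb]), ([Gd], [Gd])]"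

definition J_minus :: "real \<Rightarrow> lgen ncpoly" where
  "J_minus q = (q / sqrt (qnum q 2)) \<cdot> (eK * eF)"

definition J_three :: "real \<Rightarrow> lgen ncpoly" where
  "J_three q = (1 / qnum q 2) \<cdot> ((1 / q) \<cdot> (eE * eF) - q \<cdot> (eF * eE))"

definition J_plus :: "real \<Rightarrow> lgen ncpoly" where
  "J_plus q = (- 1 / sqrt (qnum q 2)) \<cdot> eE"

definition W_cas :: "real \<Rightarrow> lgen ncpoly" where
  "W_cas q = eK - qlam q \<cdot> J_three q"

section \<open>The q-Minkowski and q-Poincare algebras\<close>

definition rels_X :: "real \<Rightarrow> idx ncpoly set" where
  "rels_X q =
    {gen I0 * gen IM - gen IM * gen I0,
     gen I0 * gen IP - gen IP * gen I0,
     gen I0 * gen I3 - gen I3 * gen I0,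
     (1 / q) \<cdot> (gen IM * gen I3) - q \<cdot> (gen I3 * gen IM) + qlam q \<cdot> (gen I0 * gen IM),
     (1 / q) \<cdot> (gen I3 * gen IP) - q \<cdot> (gen IP * gen I3) + qlam q \<cdot> (gen I0 * gen IP),
     gen IM * gen IP - gen IP * gen IM - qlam q \<cdot> (gen I3 * gen I3)
       + qlam q \<cdot> (gen I0 * gen I3)}"

definition XA :: "real \<Rightarrow> idx ncpoly set ring" where
  "XA q = presented (rels_X q)"

abbreviation clsX :: "real \<Rightarrow> idx ncpoly \<Rightarrow> idx ncpoly set" where
  "clsX q \<equiv> cls (rels_X q)"

text \<open>The 4-vector representation, \<open>h \<triangleright> P\<^sub>\<nu> = (\<Sum>\<mu>. P\<^sub>\<mu> (vrep h)\<^sup>\<mu>\<^sub>\<nu>)\<close>.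
  Under \<open>U\<^sub>q(su\<^sub>2)\<close>, \<open>P\<^sub>0\<close> is a scalar and \<open>P\<^sub>A\<close> transforms as \<open>J\<^sub>A\<close> under the left adjoint
  action \<open>h\<^sub>(\<^sub>1\<^sub>) x S(h\<^sub>(\<^sub>2\<^sub>))\<close>.  The matrices of \<open>a, b, c, d\<close> are then determined, up to a common
  sign, by the relations of the q-Lorentz algebra together with compatibility with the
  relations of the \<open>P\<^sub>\<mu>\<close>; the sign is the one for which \<open>a\<close> and \<open>d\<close> become the identity
  as \<open>q \<longrightarrow> 1\<close>.\<close>

fun vrep_gen :: "real \<Rightarrow> lgen \<Rightarrow> idx \<Rightarrow> idx \<Rightarrow> real" where
  "vrep_gen q GE = (let t = sqrt (qnum q 2) in mat
     [[0, 0, 0, 0],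
      [0, 0, 0, 0],
      [0, 0, 0, q * t],
      [0, t, 0, 0]])"
| "vrep_gen q GF = (let t = sqrt (qnum q 2) in mat
     [[0, 0, 0, 0],
      [0, 0, 0, t],
      [0, 0, 0, 0],
      [0, 0, t / q, 0]])"
| "vrep_gen q GK = mat
     [[1, 0, 0, 0],
      [0, 1 / q\<^sup>2, 0, 0],
      [0, 0, q\<^sup>2, 0],
      [0, 0, 0, 1]]"
| "vrep_gen q GKi = mat
     [[1, 0, 0, 0],
      [0, q\<^sup>2, 0, 0],
      [0, 0, 1 / q\<^sup>2, 0],
      [0, 0, 0, 1]]"
| "vrep_gen q Ga = (let l = qlam q / qnum q 2 in mat
     [[qnum q 4 / (qnum q 2)\<^sup>2, 0, 0, q * l],
      [0, 1, 0, 0],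
      [0, 0, 1, 0],
      [l / q, 0, 0, 2 / qnum q 2]])"
| "vrep_gen q Gb = (let g = q powr (-1/2) * qlam q / sqrt (qnum q 2) in mat
     [[0, - g, 0, 0],
      [0, 0, 0, 0],
      [g, 0, 0, g],
      [0, g, 0, 0]])"
| "vrep_gen q Gc = (let g = q powr (1/2) * qlam q / sqrt (qnum q 2) in mat
     [[0, 0, g, 0],
      [- g, 0, 0, - g],
      [0, 0, 0, 0],
      [0, 0, - g, 0]])"
| "vrep_gen q Gd = (let l = qlam q / qnum q 2 in mat
     [[qnum q 4 / (qnum q 2)\<^sup>2, 0, 0, - (l / q)],
      [0, 1, 0, 0],
      [0, 0, 1, 0],
      [- (q * l), 0, 0, 2 / qnum q 2]])"

fun vrep :: "real \<Rightarrow> lgen list \<Rightarrow> idx \<Rightarrow> idx \<Rightarrow> real" where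
  "vrep q [] \<mu> \<nu> = (if \<mu> = \<nu> then 1 else 0)"
| "vrep q (g # u) \<mu> \<nu> = (\<Sum>\<kappa>\<in>UNIV. vrep_gen q g \<mu> \<kappa> * vrep q u \<kappa> \<nu>)"

definition freeH :: "lgen ncpoly \<Rightarrow> (lgen + idx) ncpoly" where
  "freeH = lift scal (\<lambda>g. gen (Inl g))"

definition freeX :: "idx ncpoly \<Rightarrow> (lgen + idx) ncpoly" where
  "freeX = lift scal (\<lambda>\<mu>. gen (Inr \<mu>))"

text \<open>The cross relations \<open>h x = (h\<^sub>(\<^sub>1\<^sub>) \<triangleright> x) h\<^sub>(\<^sub>2\<^sub>)\<close> for generators \<open>h\<close> and \<open>x\<close>;
  they imply those for arbitrary \<open>h\<close> and \<open>x\<close>.\<close>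

definition rels_semi :: "real \<Rightarrow> (lgen + idx) ncpoly set" where
  "rels_semi q = {gen (Inl g) * gen (Inr \<nu>)
      - (\<Sum>(u, v)\<leftarrow>coprod g. (\<Sum>\<mu>\<in>UNIV. vrep q u \<mu> \<nu> \<cdot> gen (Inr \<mu>)) * wmono (map Inl v)) | g \<nu>. True}"

definition rels_A :: "real \<Rightarrow> (lgen + idx) ncpoly set" where
  "rels_A q = freeH ` rels_H q \<union> freeX ` rels_X q \<union> rels_semi q"

definition PA :: "real \<Rightarrow> (lgen + idx) ncpoly set ring" where
  "PA q = presented (rels_A q)"

abbreviation clsA :: "real \<Rightarrow> (lgen + idx) ncpoly \<Rightarrow> (lgen + idx) ncpoly set" where
  "clsA q \<equiv> cls (rels_A q)"

definition inclH :: "real \<Rightarrow> lgen ncpoly set \<Rightarrow> (lgen + idx) ncpoly set" where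
  "inclH q = induced (\<lambda>h. clsA q (freeH h))"

definition inclX :: "real \<Rightarrow> idx ncpoly set \<Rightarrow> (lgen + idx) ncpoly set" where
  "inclX q = induced (\<lambda>x. clsA q (freeX x))"

section \<open>The q-Pauli-Lubanski vector and the little algebra\<close>

definition L_plus :: "real \<Rightarrow> idx \<Rightarrow> idx \<Rightarrow> lgen ncpoly" where
  "L_plus q = (let s = q powr (1/2) * sqrt (qnum q 2) in mat
     [[1, 0, 0, 0],
      [0, ea * ea, eb * eb, s \<cdot> (ea * eb)],
      [0, ec * ec, ed * ed, s \<cdot> (ec * ed)],
      [0, s \<cdot> (ea * ec), s \<cdot> (eb * ed), 1 + qnum q 2 \<cdot> (eb * ec)]])"

definition L_minus :: "real \<Rightarrow> idx \<Rightarrow> idx \<Rightarrow> lgen ncpoly" where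
  "L_minus q = (let l = qlam q; W = W_cas q; Jm = J_minus q; Jp = J_plus q; J3 = J_three q in mat
     [[W, l \<cdot> (eKi * Jm), l \<cdot> (eKi * Jp), W - eKi],
      [(- l / q) \<cdot> Jp, 1, 0, (- l / q) \<cdot> Jp],
      [(- q * l) \<cdot> Jm, 0, 1, (- q * l) \<cdot> Jm],
      [l \<cdot> J3, (- l) \<cdot> (eKi * Jm), (- l) \<cdot> (eKi * Jp), l \<cdot> J3 + eKi]])"

definition PL :: "real \<Rightarrow> idx \<Rightarrow> (lgen + idx) ncpoly set" where
  "PL q \<nu> = clsA q (scal (complex_of_real (1 / qlam q))) \<otimes>\<^bsub>PA q\<^esub>
     (\<Oplus>\<^bsub>PA q\<^esub>\<mu>\<in>UNIV. inclH q (antipode q (antipode q (clsH q (L_minus q \<mu> \<nu> - L_plus q \<mu> \<nu>))))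
        \<otimes>\<^bsub>PA q\<^esub> inclX q (clsX q (gen \<mu>)))"

definition chi :: "(idx \<Rightarrow> complex) \<Rightarrow> idx ncpoly set \<Rightarrow> complex" where
  "chi p = induced (lift id p)"

text \<open>\<open>f\<close> is the linear map \<open>\<Sum>\<^sub>i h\<^sub>i x\<^sub>i \<mapsto> \<Sum>\<^sub>i h\<^sub>i \<chi>\<^sub>p(x\<^sub>i)\<close>.\<close>

definition is_chi_hat ::
  "real \<Rightarrow> (idx \<Rightarrow> complex) \<Rightarrow> ((lgen + idx) ncpoly set \<Rightarrow> lgen ncpoly set) \<Rightarrow> bool" where
  "is_chi_hat q p f \<longleftrightarrow>
     f \<in> carrier (PA q) \<rightarrow> carrier (HA q) \<and>
     (\<forall>y\<in>carrier (PA q). \<forall>z\<in>carrier (PA q). f (y \<oplus>\<^bsub>PA q\<^esub> z) = f y \<oplus>\<^bsub>HA q\<^esub> f z) \<and>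
     (\<forall>c. \<forall>y\<in>carrier (PA q).
        f (clsA q (scal c) \<otimes>\<^bsub>PA q\<^esub> y) = clsH q (scal c) \<otimes>\<^bsub>HA q\<^esub> f y) \<and>
     (\<forall>h\<in>carrier (HA q). \<forall>x\<in>carrier (XA q).
        f (inclH q h \<otimes>\<^bsub>PA q\<^esub> inclX q x) = h \<otimes>\<^bsub>HA q\<^esub> clsH q (scal (chi p x)))"

definition rest_momentum :: "real \<Rightarrow> idx \<Rightarrow> complex" where
  "rest_momentum m \<mu> = (if \<mu> = I0 then complex_of_real m else 0)"

definition massive_little_alg ::
  "real \<Rightarrow> ((lgen + idx) ncpoly set \<Rightarrow> lgen ncpoly set) \<Rightarrow> lgen ncpoly set set" where
  "massive_little_alg q f = subalg q (range (\<lambda>\<mu>. f (PL q \<mu>)) \<union> {clsH q eK})"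

end

theory Submission
  imports Defs
begin

text \<open>
  The image of \<open>W\<^sub>\<nu>\<close> at rest momentum is \<open>m \<lambda>\<^sup>-\<^sup>1 S\<^sup>2\<close> of the entry \<open>(0, \<nu>)\<close> of \<open>L\<^sub>- - L\<^sub>+\<close>, because
  \<open>W\<^sub>\<nu>\<close> is given in the form \<open>\<Sum>\<^sub>\<mu> h\<^sub>\<mu> P\<^sub>\<mu>\<close> and \<open>P\<^sub>\<mu>\<close> is evaluated to \<open>m \<delta>\<^sub>\<mu>\<^sub>0\<close> (lemma \<open>chi_hat_PL\<close>).  Row \<open>0\<close>
  of the difference is \<open>(W - 1, \<lambda> K\<^sup>-\<^sup>1 J\<^sub>-, \<lambda> K\<^sup>-\<^sup>1 J\<^sub>+, W - K\<^sup>-\<^sup>1)\<close> and lies in \<open>U\<^sub>q(su\<^sub>2)\<close>, where \<open>S\<^sup>2\<close> is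
  conjugation by \<open>K\<close>.  Conjugation fixes \<open>W\<close> and turns \<open>K\<^sup>-\<^sup>1 J\<^sub>A\<close> into \<open>J\<^sub>A K\<^sup>-\<^sup>1\<close>, which gives the four
  values (lemma \<open>chi_hat_values\<close>).  These values and \<open>K\<close> lie in \<open>U\<^sub>q(su\<^sub>2)\<close>; conversely the components
  \<open>0\<close> and \<open>3\<close> differ by a nonzero multiple of \<open>K\<^sup>-\<^sup>1 - 1\<close>, so \<open>K\<^sup>-\<^sup>1\<close> is recovered, and then \<open>E\<close> and \<open>F\<close> are
  recovered from the components \<open>+\<close> and \<open>-\<close>.

  The bulk of the work is that these computations with representatives are legitimate.  The
  algebras are quotients of free algebras, and antipode, inclusions and \<open>\<chi>\<close> are induced from maps
  of the free algebras, so each of these maps has to send relations into the ideal of relations.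
  This is immediate for the inclusions and for \<open>\<chi>\<close>.  For the antipode it is a statement about each of
  the defining relations of the q-Lorentz algebra: its image under the antihomomorphism must
  reduce to \<open>0\<close>.  The reductions use the relations as straightening rules on words of length two
  (lemma \<open>straight_in_ideal\<close>) and are recorded as explicit elements of the ideal (lemmas
  \<open>antipode_rels_U\<close>, \<open>antipode_rels_SU\<close>, \<open>antipode_rels_cross\<close>).
\<close>

section \<open>Homomorphisms out of a free algebra\<close>

lemma ncpoly_induct [case_names single add]:
  fixes f :: "'g ncpoly"
  assumes "\<And>w c. P (Poly_Mapping.single w c)" and "\<And>f g. P f \<Longrightarrow> P g \<Longrightarrow> P (f + g)"
  shows "P f"
proof -
  have "P (\<Sum>w\<in>A. Poly_Mapping.single w (Poly_Mapping.lookup f w))" if "finite A" for A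
    using that
  proof induction
    case empty
    show ?case using assms(1)[of 0 0] by simp
  qed (simp add: assms)
  moreover have "(\<Sum>w\<in>Poly_Mapping.keys f. Poly_Mapping.single w (Poly_Mapping.lookup f w)) = f"
    by (rule poly_mapping_eqI)
      (auto simp: lookup_sum lookup_single when_def sum.delta in_keys_iff)
  ultimately show ?thesis
    by (metis finite_keys)
qed

text \<open>Centrality of the scalars is what makes \<^const>\<open>lift\<close> multiplicative.  The targets used are free
  algebras, where the scalars are central although the algebra is not commutative, and \<open>\<complex>\<close>.\<close>

locale central_scalars =
  fixes s :: "complex \<Rightarrow> 'r::ring_1"
  assumes s_add: "s (c + d) = s c + s d"
    and s_mult: "s (c * d) = s c * s d"
    and s_one: "s 1 = 1"
    and s_central: "s c * x = x * s c"
begin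

lemma s_zero: "s 0 = 0"
  using s_add[of 0 0] by simp

text \<open>\<^const>\<open>lift\<close> and \<^const>\<open>anti_lift\<close> are sums over the support of their argument, which is not
  additive in the argument; padding to the union of both supports makes the sum linear.\<close>

lemma linear_ext_add:
  "(\<Sum>w\<in>Poly_Mapping.keys (f + g). s (Poly_Mapping.lookup (f + g) w) * v w) =
   (\<Sum>w\<in>Poly_Mapping.keys f. s (Poly_Mapping.lookup f w) * v w) +
   (\<Sum>w\<in>Poly_Mapping.keys g. s (Poly_Mapping.lookup g w) * v w)"
proof -
  let ?A = "Poly_Mapping.keys f \<union> Poly_Mapping.keys g"
  have *: "(\<Sum>w\<in>Poly_Mapping.keys h. s (Poly_Mapping.lookup h w) * v w) =
      (\<Sum>w\<in>?A. s (Poly_Mapping.lookup h w) * v w)" if "Poly_Mapping.keys h \<subseteq> ?A" for h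
    using that by (intro sum.mono_neutral_left) (auto simp: in_keys_iff s_zero)
  show ?thesis
    by (subst (1 2 3) *) (auto simp: keys_add lookup_add s_add distrib_right sum.distrib)
qed

lemma lift_single: "lift s \<phi> (Poly_Mapping.single w c) = s c * prod_list (map \<phi> (letters w))"
  by (simp add: lift_def s_zero)

lemma anti_lift_single:
  "anti_lift s \<phi> (Poly_Mapping.single w c) = s c * prod_list (map \<phi> (rev (letters w)))"
  by (simp add: anti_lift_def s_zero)

lemma lift_add: "lift s \<phi> (f + g) = lift s \<phi> f + lift s \<phi> g"
  unfolding lift_def by (rule linear_ext_add)

lemma anti_lift_add: "anti_lift s \<phi> (f + g) = anti_lift s \<phi> f + anti_lift s \<phi> g"
  unfolding anti_lift_def by (rule linear_ext_add)

lemma s_swap: "(s c * x) * (s d * y) = s (c * d) * (x * y)"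
  by (simp add: s_mult mult.assoc) (metis mult.assoc s_central)

lemma lift_mult: "lift s \<phi> (f * g) = lift s \<phi> f * lift s \<phi> g"
proof (induction f rule: ncpoly_induct)
  case (single u c)
  show ?case
  proof (induction g rule: ncpoly_induct)
    case (single v d)
    show ?case
      by (simp add: mult_single lift_single s_swap plus_ncword_def)
  qed (simp add: distrib_left lift_add)
qed (simp add: distrib_right lift_add)

lemma anti_lift_mult: "anti_lift s \<phi> (f * g) = anti_lift s \<phi> g * anti_lift s \<phi> f"
proof (induction f rule: ncpoly_induct)
  case (single u c)
  show ?case
  proof (induction g rule: ncpoly_induct)
    case (single v d)
    show ?case
      by (simp add: mult_single anti_lift_single s_swap plus_ncword_def mult.commute[of c d])
  qed (simp add: distrib_left distrib_right anti_lift_add)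
qed (simp add: distrib_left distrib_right anti_lift_add)

lemma lift_basic:
  "lift s \<phi> (- x) = - lift s \<phi> x" "lift s \<phi> (x - y) = lift s \<phi> x - lift s \<phi> y"
  "lift s \<phi> 0 = 0" "lift s \<phi> 1 = 1" "lift s \<phi> (scal c) = s c"
  "lift s \<phi> (gen g) = \<phi> g" "lift s \<phi> (r \<cdot> x) = s (complex_of_real r) * lift s \<phi> x"
proof -
  show zero: "lift s \<phi> 0 = 0"
    by (simp add: lift_def)
  show diff: "lift s \<phi> (x - y) = lift s \<phi> x - lift s \<phi> y" for x y
    using lift_add[of \<phi> "x - y" y] by (simp add: algebra_simps)
  show "lift s \<phi> (- x) = - lift s \<phi> x"
    using diff[of 0 x] by (simp add: zero)
  show scal: "lift s \<phi> (scal c) = s c" for c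
    by (simp add: scal_def lift_single zero_ncword_def)
  show "lift s \<phi> 1 = 1"
    using scal[of 1] by (simp add: scal_def s_one)
  show "lift s \<phi> (gen g) = \<phi> g"
    by (simp add: gen_def wmono_def lift_single s_one)
  show "lift s \<phi> (r \<cdot> x) = s (complex_of_real r) * lift s \<phi> x"
    by (simp add: rscale_def lift_mult scal)
qed

lemma anti_lift_basic:
  "anti_lift s \<phi> (- x) = - anti_lift s \<phi> x"
  "anti_lift s \<phi> (x - y) = anti_lift s \<phi> x - anti_lift s \<phi> y"
  "anti_lift s \<phi> 0 = 0" "anti_lift s \<phi> 1 = 1"
  "anti_lift s \<phi> (gen g) = \<phi> g"
  "anti_lift s \<phi> (r \<cdot> x) = s (complex_of_real r) * anti_lift s \<phi> x"
proof -
  show zero: "anti_lift s \<phi> 0 = 0"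
    by (simp add: anti_lift_def)
  show diff: "anti_lift s \<phi> (x - y) = anti_lift s \<phi> x - anti_lift s \<phi> y" for x y
    using anti_lift_add[of \<phi> "x - y" y] by (simp add: algebra_simps)
  show "anti_lift s \<phi> (- x) = - anti_lift s \<phi> x"
    using diff[of 0 x] by (simp add: zero)
  have scal: "anti_lift s \<phi> (scal c) = s c" for c
    by (simp add: scal_def anti_lift_single zero_ncword_def)
  show "anti_lift s \<phi> 1 = 1"
    using scal[of 1] by (simp add: scal_def s_one)
  show "anti_lift s \<phi> (gen g) = \<phi> g"
    by (simp add: gen_def wmono_def anti_lift_single s_one)
  show "anti_lift s \<phi> (r \<cdot> x) = s (complex_of_real r) * anti_lift s \<phi> x"
    by (simp add: rscale_def anti_lift_mult scal s_central)
qed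

end

lemma central_scal: "central_scalars scal"
proof
  show "scal c * x = x * scal c" for c and x :: "'g ncpoly"
  proof (induction x rule: ncpoly_induct)
    case (single w d)
    show ?case by (simp add: scal_def mult_single mult.commute)
  qed (simp add: distrib_left distrib_right)
qed (simp_all add: scal_def single_add mult_single)

lemma central_id: "central_scalars (id :: complex \<Rightarrow> complex)"
  by standard simp_all

section \<open>Identities between noncommutative polynomials\<close>

lemma rscale_rules:
  "r \<cdot> (x + y) = r \<cdot> x + r \<cdot> y" "r \<cdot> (x - y) = r \<cdot> x - r \<cdot> y" "r \<cdot> (- x) = - (r \<cdot> x)"
  "(r \<cdot> x) * y = r \<cdot> (x * y)" "x * (r \<cdot> y) = r \<cdot> (x * y)"
proof -
  have "x * (scal c * y) = scal c * (x * y)" for c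
    using central_scalars.s_central[OF central_scal, of c x] by (simp flip: mult.assoc)
  then show "x * (r \<cdot> y) = r \<cdot> (x * y)"
    by (simp add: rscale_def)
qed (simp_all add: rscale_def distrib_left right_diff_distrib mult.assoc)

lemma anti_lift_rscale: "anti_lift scal \<phi> (r \<cdot> x) = r \<cdot> anti_lift scal \<phi> x"
  by (simp only: central_scalars.anti_lift_basic(6)[OF central_scal]) (simp add: rscale_def)

lemma rscale_rscale: "r \<cdot> (s \<cdot> x) = (r * s) \<cdot> x"
  by (simp add: rscale_def scal_def mult_single flip: mult.assoc)

lemma rscale_one: "1 \<cdot> x = x"
  by (simp add: rscale_def scal_def)

lemma lookup_rscale: "Poly_Mapping.lookup (r \<cdot> x) w = complex_of_real r * Poly_Mapping.lookup x w"
proof (induction x rule: ncpoly_induct)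
  case (single v c)
  show ?case by (simp add: rscale_def scal_def mult_single lookup_single when_def)
qed (simp add: rscale_def distrib_left lookup_add)

lemma wmono_mult: "wmono u * wmono v = wmono (u @ v)"
  by (simp add: wmono_def mult_single plus_ncword_def)

lemma one_conv_wmono: "1 = wmono []"
  by (simp add: wmono_def flip: zero_ncword_def)

text \<open>Identities between explicit noncommutative polynomials are decided by multiplying out with
  the first list and comparing the coefficients of all words with the second; the unknown
  coefficients \<open>lookup (wmono w) k\<close> then enter linearly and act as independent atoms, so that an
  identity in the field \<open>\<complex>\<close> remains.\<close>

lemmas multiply_out = distrib_left distrib_right left_diff_distrib right_diff_distrib
  rscale_rules rscale_rscale mult.assoc
lemmas compare_coeffs = gen_def wmono_mult lookup_add lookup_minus lookup_rscale one_conv_wmono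

section \<open>Ideals of relations and presented algebras\<close>

lemma ring_free_alg: "ring (free_alg :: 'g ncpoly ring)"
proof -
  have "\<exists>y. x + y = 0" for x :: "'g ncpoly"
    using add.right_inverse by blast
  then show ?thesis
    unfolding ring_of_type_algebra_def using add.right_inverse
    by unfold_locales (auto simp: algebra_simps Units_def)
qed

lemma free_alg_simps [simp]:
  "carrier free_alg = UNIV" "x \<otimes>\<^bsub>free_alg\<^esub> y = x * y" "x \<oplus>\<^bsub>free_alg\<^esub> y = x + y"
  "\<one>\<^bsub>free_alg\<^esub> = 1" "\<zero>\<^bsub>free_alg\<^esub> = 0"
  by (simp_all add: ring_of_type_algebra_def)

lemma ideal_rel_ideal: "ideal (rel_ideal R) (free_alg :: 'g ncpoly ring)"
  unfolding rel_ideal_def by (intro ring.genideal_ideal[OF ring_free_alg]) simp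

lemma rel_ideal_incl: "r \<in> R \<Longrightarrow> r \<in> rel_ideal R"
  unfolding rel_ideal_def using ring.genideal_self[OF ring_free_alg, of R] by auto

lemma rel_ideal_zero: "0 \<in> rel_ideal R"
  using additive_subgroup.zero_closed[OF ideal.axioms(1)[OF ideal_rel_ideal]] by simp

lemma rel_ideal_add: "x \<in> rel_ideal R \<Longrightarrow> y \<in> rel_ideal R \<Longrightarrow> x + y \<in> rel_ideal R"
  using additive_subgroup.a_closed[OF ideal.axioms(1)[OF ideal_rel_ideal]] by simp

lemma rel_ideal_mult_left: "x \<in> rel_ideal R \<Longrightarrow> u * x \<in> rel_ideal R"
  using ideal.I_l_closed[OF ideal_rel_ideal] by simp

lemma rel_ideal_mult_right: "x \<in> rel_ideal R \<Longrightarrow> x * u \<in> rel_ideal R"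
  using ideal.I_r_closed[OF ideal_rel_ideal] by simp

lemma rel_ideal_minus: "x \<in> rel_ideal R \<Longrightarrow> - x \<in> rel_ideal R"
  using rel_ideal_mult_left[of x R "-1"] by simp

lemma rel_ideal_diff: "x \<in> rel_ideal R \<Longrightarrow> y \<in> rel_ideal R \<Longrightarrow> x - y \<in> rel_ideal R"
  using rel_ideal_add[of x R "- y"] rel_ideal_minus[of y R] by simp

lemma rel_ideal_rscale: "x \<in> rel_ideal R \<Longrightarrow> r \<cdot> x \<in> rel_ideal R"
  by (simp add: rscale_def rel_ideal_mult_left)

lemmas rel_ideal_closed = rel_ideal_add rel_ideal_diff rel_ideal_minus rel_ideal_rscale
  rel_ideal_mult_left rel_ideal_mult_right

text \<open>The induction principle for relation ideals: a linear map that is multiplicative or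
  antimultiplicative respects a presentation as soon as it kills the relations.\<close>

lemma rel_ideal_least:
  assumes "R \<subseteq> J" "0 \<in> J" "\<And>x y. x \<in> J \<Longrightarrow> y \<in> J \<Longrightarrow> x + y \<in> J"
    and "\<And>u x. x \<in> J \<Longrightarrow> u * x \<in> J" "\<And>u x. x \<in> J \<Longrightarrow> x * u \<in> J"
  shows "rel_ideal R \<subseteq> J"
  unfolding rel_ideal_def
proof (rule ring.genideal_minimal[OF ring_free_alg])
  have inv: "inv\<^bsub>add_monoid free_alg\<^esub> x = - x" for x :: "'a ncpoly"
    by (rule group.inv_equality[OF abelian_group.a_group[OF ring.is_abelian_group[OF ring_free_alg]]])
      simp_all
  show "ideal J free_alg"
  proof (rule idealI[OF ring_free_alg])
    show "subgroup J (add_monoid free_alg)"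
    proof (rule subgroup.intro)
      show "inv\<^bsub>add_monoid free_alg\<^esub> x \<in> J" if "x \<in> J" for x
        using assms(4)[OF that, of "-1"] inv[of x] by simp
    qed (use assms in auto)
  qed (use assms in auto)
qed fact

lemma ring_presented: "ring (presented R)"
  unfolding presented_def by (rule ideal.quotient_is_ring[OF ideal_rel_ideal])

lemma cls_eq_iff: "cls R x = cls R y \<longleftrightarrow> x - y \<in> rel_ideal R"
proof -
  have minus: "x \<ominus>\<^bsub>free_alg\<^esub> y = x - y"
  proof -
    interpret ring "free_alg :: 'a ncpoly ring" by (rule ring_free_alg)
    have "y \<oplus>\<^bsub>free_alg\<^esub> (x \<ominus>\<^bsub>free_alg\<^esub> y) = x"
      using minus_eq r_neg[of y] by (simp add: a_ac)
    then show ?thesis by (simp add: algebra_simps)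
  qed
  show ?thesis
    using ring.quotient_eq_iff_same_a_r_cos[OF ring_free_alg ideal_rel_ideal, of x y R]
    by (simp add: cls_def minus)
qed

lemma presented_simps:
  "cls R x \<oplus>\<^bsub>presented R\<^esub> cls R y = cls R (x + y)"
  "cls R x \<otimes>\<^bsub>presented R\<^esub> cls R y = cls R (x * y)"
  "\<zero>\<^bsub>presented R\<^esub> = cls R 0" "\<one>\<^bsub>presented R\<^esub> = cls R 1"
  "carrier (presented R) = range (cls R)"
proof -
  interpret I: ideal "rel_ideal R" free_alg by (rule ideal_rel_ideal)
  have hom: "cls R \<in> ring_hom free_alg (presented R)"
    using I.rcos_ring_hom unfolding cls_def presented_def by simp
  show "cls R x \<oplus>\<^bsub>presented R\<^esub> cls R y = cls R (x + y)"
    "cls R x \<otimes>\<^bsub>presented R\<^esub> cls R y = cls R (x * y)"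
    "\<one>\<^bsub>presented R\<^esub> = cls R 1"
    using ring_hom_add[OF hom, of x y] ring_hom_mult[OF hom, of x y] ring_hom_one[OF hom]
    by simp_all
  show "\<zero>\<^bsub>presented R\<^esub> = cls R 0"
    using ring_hom_zero[OF hom ring_free_alg ring_presented] by simp
  show "carrier (presented R) = range (cls R)"
    by (auto simp: presented_def cls_def FactRing_def A_RCOSETS_defs a_r_coset_def r_coset_def)
qed

lemma rel_ideal_lift:
  assumes "\<And>r. r \<in> R \<Longrightarrow> lift scal \<phi> r \<in> rel_ideal R'" and "x \<in> rel_ideal R"
  shows "lift scal \<phi> x \<in> rel_ideal R'"
proof -
  interpret central_scalars scal by (rule central_scal)
  have "rel_ideal R \<subseteq> {x. lift scal \<phi> x \<in> rel_ideal R'}"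
    by (rule rel_ideal_least) (auto simp: assms(1) lift_basic lift_add lift_mult
      rel_ideal_zero rel_ideal_closed)
  with assms(2) show ?thesis by blast
qed

lemma rel_ideal_anti_lift:
  assumes "\<And>r. r \<in> R \<Longrightarrow> anti_lift scal \<phi> r \<in> rel_ideal R'" and "x \<in> rel_ideal R"
  shows "anti_lift scal \<phi> x \<in> rel_ideal R'"
proof -
  interpret central_scalars scal by (rule central_scal)
  have "rel_ideal R \<subseteq> {x. anti_lift scal \<phi> x \<in> rel_ideal R'}"
    by (rule rel_ideal_least) (auto simp: assms(1) anti_lift_basic anti_lift_add anti_lift_mult
      rel_ideal_zero rel_ideal_closed)
  with assms(2) show ?thesis by blast
qed

text \<open>\<^const>\<open>induced\<close> is meaningful only where the map is constant on the coset, since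
  \<^const>\<open>the_elem\<close> of a set with several elements is unspecified.\<close>

lemma induced_cls:
  assumes "\<And>y. x - y \<in> rel_ideal R \<Longrightarrow> f x = f y"
  shows "induced f (cls R x) = f x"
proof -
  interpret I: ideal "rel_ideal R" free_alg by (rule ideal_rel_ideal)
  have "f ` cls R x = {f x}"
  proof -
    have "f y = f x" if "y \<in> cls R x" for y
    proof -
      from that obtain h where "h \<in> rel_ideal R" "y = h + x"
        by (auto simp: cls_def a_r_coset_def r_coset_def)
      then show ?thesis
        using assms[of y] rel_ideal_minus[of h R] by simp
    qed
    moreover have "x \<in> cls R x"
      using I.a_rcos_self[of x] by (simp add: cls_def)
    ultimately show ?thesis by blast
  qed
  then show ?thesis by (simp add: induced_def)
qed

section \<open>Straightening words in the q-Lorentz algebra\<close>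

text \<open>The relations of the q-Lorentz algebra, completed by their immediate consequences, as
  rewrite rules on words of length two towards the order \<open>K, E, F, a, b, c, d\<close>.  The parameter
  is \<open>t = q\<^sup>1\<^sup>/\<^sup>2\<close>, so that the half-integral powers of \<open>q\<close> in the cross relations become
  powers of \<open>t\<close> and all identities below are between Laurent polynomials in \<open>t\<close>.\<close>

fun straighten :: "real \<Rightarrow> lgen \<Rightarrow> lgen \<Rightarrow> lgen ncpoly" where
  "straighten t GK GKi = 1"
| "straighten t GKi GK = 1"
| "straighten t GE GK = (1 / t ^ 4) \<cdot> (eK * eE)"
| "straighten t GF GK = t ^ 4 \<cdot> (eK * eF)"
| "straighten t GE GKi = t ^ 4 \<cdot> (eKi * eE)"
| "straighten t GF GKi = (1 / t ^ 4) \<cdot> (eKi * eF)"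
| "straighten t GF GE = eE * eF - (1 / qlam (t\<^sup>2)) \<cdot> (eK - eKi)"
| "straighten t Gb Ga = t\<^sup>2 \<cdot> (ea * eb)"
| "straighten t Gc Ga = t\<^sup>2 \<cdot> (ea * ec)"
| "straighten t Gd Gb = t\<^sup>2 \<cdot> (eb * ed)"
| "straighten t Gd Gc = t\<^sup>2 \<cdot> (ec * ed)"
| "straighten t Gc Gb = eb * ec"
| "straighten t Gd Ga = 1 + t\<^sup>2 \<cdot> (eb * ec)"
| "straighten t Ga Gd = 1 + (1 / t\<^sup>2) \<cdot> (eb * ec)"
| "straighten t Ga GE = t\<^sup>2 \<cdot> (eE * ea) - t ^ 3 \<cdot> eb"
| "straighten t Gb GE = (1 / t\<^sup>2) \<cdot> (eE * eb)"
| "straighten t Gc GE = t\<^sup>2 \<cdot> (eE * ec) + t ^ 3 \<cdot> (eK * ea) - t ^ 3 \<cdot> ed"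
| "straighten t Gd GE = (1 / t\<^sup>2) \<cdot> (eE * ed) + (1 / t) \<cdot> (eK * eb)"
| "straighten t Ga GF = t\<^sup>2 \<cdot> (eF * ea) + (1 / t) \<cdot> ec"
| "straighten t Gb GF = t\<^sup>2 \<cdot> (eF * eb) - (1 / t) \<cdot> (eKi * ea) + (1 / t) \<cdot> ed"
| "straighten t Gc GF = (1 / t\<^sup>2) \<cdot> (eF * ec)"
| "straighten t Gd GF = (1 / t\<^sup>2) \<cdot> (eF * ed) - (1 / t ^ 5) \<cdot> (eKi * ec)"
| "straighten t Ga GK = eK * ea"
| "straighten t Gb GK = (1 / t ^ 4) \<cdot> (eK * eb)"
| "straighten t Gc GK = t ^ 4 \<cdot> (eK * ec)"
| "straighten t Gd GK = eK * ed"
| "straighten t Ga GKi = eKi * ea"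
| "straighten t Gb GKi = t ^ 4 \<cdot> (eKi * eb)"
| "straighten t Gc GKi = (1 / t ^ 4) \<cdot> (eKi * ec)"
| "straighten t Gd GKi = eKi * ed"
| "straighten t x y = gen x * gen y"

text \<open>As this is \<open>0\<close> for words to which no rule applies, that it lies in the ideal can be stated
  for all pairs at once.\<close>

definition straight :: "real \<Rightarrow> lgen \<Rightarrow> lgen \<Rightarrow> lgen ncpoly" where
  "straight t x y = gen x * gen y - straighten t x y"

lemma rel_ideal_cong: "y \<in> rel_ideal R \<Longrightarrow> x = y \<Longrightarrow> x \<in> rel_ideal R"
  by simp

context
  fixes t :: real
  assumes t: "t > 1"
begin

abbreviation (input) \<I> :: "lgen ncpoly set" where "\<I> \<equiv> rel_ideal (rels_H (t\<^sup>2))"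

abbreviation (input) \<sigma> where "\<sigma> \<equiv> straight t"

lemma t0: "t \<noteq> 0"
  using t by simp

lemma powers:
  "(t\<^sup>2) powr (3/2) = t ^ 3" "(t\<^sup>2) powr (-1/2) = 1 / t" "(t\<^sup>2) powr (-5/2) = 1 / t ^ 5"
proof -
  have *: "(t\<^sup>2) powr x = t powr (2 * x)" for x
    using t powr_powr[of t 2 x] by simp
  show "(t\<^sup>2) powr (3/2) = t ^ 3" "(t\<^sup>2) powr (-1/2) = 1 / t" "(t\<^sup>2) powr (-5/2) = 1 / t ^ 5"
    using t by (simp_all add: * powr_minus_divide powr_numeral)
qed

lemma relsI:
  "r \<in> rels_U (t\<^sup>2) \<Longrightarrow> r \<in> \<I>" "r \<in> rels_SU (t\<^sup>2) \<Longrightarrow> r \<in> \<I>" "r \<in> rels_cross (t\<^sup>2) \<Longrightarrow> r \<in> \<I>"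
  by (simp_all add: rel_ideal_incl rels_H_def)

lemma straight_UK: "\<sigma> GK GKi \<in> \<I>" "\<sigma> GKi GK \<in> \<I>" "\<sigma> GF GE \<in> \<I>"
proof -
  show "\<sigma> GK GKi \<in> \<I>" "\<sigma> GKi GK \<in> \<I>"
    by (intro relsI; simp add: straight_def rels_U_def)+
  have "eE * eF - eF * eE - (1 / qlam (t\<^sup>2)) \<cdot> (eK - eKi) \<in> \<I>"
    by (intro relsI; simp add: rels_U_def)
  from rel_ideal_minus[OF this] show "\<sigma> GF GE \<in> \<I>"
    by (simp add: straight_def algebra_simps)
qed

lemma straight_cross:
  assumes "x \<in> {Ga, Gb, Gc, Gd}" "y \<in> {GE, GF, GK}"
  shows "\<sigma> x y \<in> \<I>"
proof -
  have "\<sigma> x y \<in> rels_cross (t\<^sup>2)"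
    unfolding rels_cross_def powers using assms
    by (elim insertE emptyE; simp add: straight_def)
  then show ?thesis by (rule relsI(3))
qed

lemma straight_SU:
  assumes "x \<in> {Ga, Gb, Gc, Gd}" "y \<in> {Ga, Gb, Gc, Gd}"
  shows "\<sigma> x y \<in> \<I>"
proof -
  have 1: "\<sigma> Gb Ga \<in> \<I>" "\<sigma> Gc Ga \<in> \<I>" "\<sigma> Gd Gb \<in> \<I>"
    "\<sigma> Gd Gc \<in> \<I>" "\<sigma> Gd Ga \<in> \<I>"
    by (rule relsI(2), simp add: straight_def rels_SU_def algebra_simps)+
  have 2: "eb * ec - ec * eb \<in> \<I>" "ed * ea - ea * ed - qlam (t\<^sup>2) \<cdot> (eb * ec) \<in> \<I>"
    by (rule relsI(2), simp add: rels_SU_def)+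
  have 3: "\<sigma> Gc Gb \<in> \<I>"
    using rel_ideal_minus[OF 2(1)] by (simp add: straight_def)
  \<comment> \<open>The product \<open>a d\<close> is given only through \<open>d a\<close> and the commutator \<open>d a - a d\<close>.\<close>
  have "\<sigma> Ga Gd \<in> \<I>"
    by (rule rel_ideal_cong[OF rel_ideal_diff[OF 1(5) 2(2)]], rule poly_mapping_eqI)
       (use t in \<open>simp add: straight_def qlam_def multiply_out compare_coeffs algebra_simps\<close>)
  with 1 3 show ?thesis
    using assms by (auto simp: rel_ideal_zero straight_def)
qed

text \<open>Only \<open>K E K\<^sup>-\<^sup>1\<close> and \<open>K F K\<^sup>-\<^sup>1\<close> are given; multiplying by \<open>K\<^sup>-\<^sup>1\<close> from the left or by \<open>K\<close> from
  the right turns them into commutation rules.\<close>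

lemma straight_K:
  assumes "x \<in> {GE, GF}" "y \<in> {GK, GKi}"
  shows "\<sigma> x y \<in> \<I>"
proof -
  have E: "eK * eE * eKi - (t\<^sup>2)\<^sup>2 \<cdot> eE \<in> \<I>" and F: "eK * eF * eKi - (1 / (t\<^sup>2)\<^sup>2) \<cdot> eF \<in> \<I>"
    by (rule relsI(1), simp add: rels_U_def)+
  have "x * eKi - r \<cdot> (eKi * x) \<in> \<I>" "x * eK - (1 / r) \<cdot> (eK * x) \<in> \<I>"
    if "eK * x * eKi - r \<cdot> x \<in> \<I>" "r \<noteq> 0" for x r
  proof -
    have "eKi * (eK * x * eKi - r \<cdot> x) - \<sigma> GKi GK * (x * eKi) \<in> \<I>"
      by (intro rel_ideal_closed straight_UK that)
    then show "x * eKi - r \<cdot> (eKi * x) \<in> \<I>"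
      by (simp add: straight_def algebra_simps rscale_rules)
    have "- ((1 / r) \<cdot> ((eK * x * eKi - r \<cdot> x) * eK - eK * x * \<sigma> GKi GK)) \<in> \<I>"
      by (intro rel_ideal_closed straight_UK that)
    then show "x * eK - (1 / r) \<cdot> (eK * x) \<in> \<I>"
      using that(2) by (simp add: straight_def algebra_simps rscale_rules rscale_rscale rscale_one)
  qed
  from this[OF E] this[OF F] show ?thesis
    using assms t by (auto simp: straight_def rscale_one)
qed

text \<open>The rule for \<open>K\<^sup>-\<^sup>1\<close> is the rule for \<open>K\<close> multiplied by \<open>K\<^sup>-\<^sup>1\<close> on both sides.\<close>

lemma straight_Ki:
  assumes "x \<in> {Ga, Gb, Gc, Gd}"
  shows "\<sigma> x GKi \<in> \<I>"
proof -
  have "gen x * eKi - (1 / r) \<cdot> (eKi * gen x) \<in> \<I>"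
    if "straighten t x GK = r \<cdot> (eK * gen x)" "r \<noteq> 0" for r
  proof -
    have "- ((1 / r) \<cdot> (eKi * \<sigma> x GK * eKi - eKi * gen x * \<sigma> GK GKi
        + r \<cdot> (\<sigma> GKi GK * gen x * eKi))) \<in> \<I>"
      by (intro rel_ideal_closed straight_UK straight_cross) (use assms in auto)
    then show ?thesis
      using that by (simp add: straight_def algebra_simps rscale_rules rscale_rscale rscale_one)
  qed
  from this[of 1] this[of "1 / t ^ 4"] this[of "t ^ 4"] show ?thesis
    using assms t by (auto simp: straight_def rscale_one)
qed

lemma straight_in_ideal: "\<sigma> x y \<in> \<I>"
proof -
  consider "x \<in> {Ga, Gb, Gc, Gd}" "y \<in> {GE, GF, GK}" | "x \<in> {Ga, Gb, Gc, Gd}" "y = GKi"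
    | "x \<in> {Ga, Gb, Gc, Gd}" "y \<in> {Ga, Gb, Gc, Gd}" | "x \<in> {GE, GF}" "y \<in> {GK, GKi}"
    | "(x, y) \<in> {(GK, GKi), (GKi, GK), (GF, GE)}" | "\<sigma> x y = 0"
    by (cases x; cases y; simp add: straight_def)
  then show ?thesis
    by cases (auto intro: straight_cross straight_Ki straight_SU straight_K straight_UK rel_ideal_zero)
qed

section \<open>The antipode on the quotient\<close>

abbreviation (input) \<S> :: "lgen ncpoly \<Rightarrow> lgen ncpoly"
  where "\<S> \<equiv> anti_lift scal (antipode_gen (t\<^sup>2))"

interpretation scal: central_scalars scal by (rule central_scal)

lemmas S_simps = scal.anti_lift_basic(1-5) scal.anti_lift_add scal.anti_lift_mult anti_lift_rscale

text \<open>In this lemma and the two after it, the right-hand sides are certificates of membership in the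
  ideal: linear combinations \<open>\<Sum>\<^sub>i u\<^sub>i \<sigma>\<^sub>i v\<^sub>i\<close> found by straightening the image of the relation under
  \<open>\<S>\<close> to \<open>0\<close> and recording every rewrite step.\<close>

lemma antipode_rels_U:
  assumes "r \<in> rels_U (t\<^sup>2)"
  shows "\<S> r \<in> \<I>"
proof -
  have "\<S> (eK * eKi - 1) = \<sigma> GK GKi" "\<S> (eKi * eK - 1) = \<sigma> GKi GK"
    by (simp_all add: straight_def S_simps)
  moreover have "\<S> (eK * eE * eKi - (t\<^sup>2)\<^sup>2 \<cdot> eE)
      = - (eK * \<sigma> GE GKi * eKi) - t ^ 4 \<cdot> (\<sigma> GK GKi * eE * eKi)"
    by (rule poly_mapping_eqI) (simp add: straight_def S_simps multiply_out t0; simp add: compare_coeffs;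
      simp add: eval_nat_numeral field_simps t0)
  moreover have "\<S> (eK * eF * eKi - (1 / (t\<^sup>2)\<^sup>2) \<cdot> eF)
      = - (eK * eK * \<sigma> GF GKi) - (1 / t ^ 4) \<cdot> (eK * \<sigma> GK GKi * eF)"
    by (rule poly_mapping_eqI) (simp add: straight_def S_simps multiply_out t0; simp add: compare_coeffs;
      simp add: eval_nat_numeral field_simps t0)
  moreover have "\<S> (eE * eF - eF * eE - (1 / qlam (t\<^sup>2)) \<cdot> (eK - eKi))
      = eK * \<sigma> GF GE * eKi + eK * eE * \<sigma> GF GKi - \<sigma> GE GKi * eK * eF
        + (1 / t ^ 4) \<cdot> (eK * \<sigma> GE GKi * eF) - t ^ 4 \<cdot> (eKi * \<sigma> GE GK * eF)
        + (\<sigma> GK GKi - \<sigma> GKi GK) * eE * eF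
        + (1 / qlam (t\<^sup>2)) \<cdot> (\<sigma> GK GKi * eKi - eK * \<sigma> GK GKi)"
    by (rule poly_mapping_eqI) (simp add: straight_def S_simps multiply_out t0; simp add: compare_coeffs;
      simp add: eval_nat_numeral field_simps t0)
  ultimately show ?thesis
    using assms unfolding rels_U_def
    by (elim insertE emptyE; simp only:; fast intro: rel_ideal_closed straight_in_ideal)
qed

lemma antipode_rels_SU:
  assumes "r \<in> rels_SU (t\<^sup>2)"
  shows "\<S> r \<in> \<I>"
proof -
  have "\<S> (eb * ea - t\<^sup>2 \<cdot> (ea * eb)) = - (t\<^sup>2 \<cdot> \<sigma> Gd Gb)"
    "\<S> (ec * ea - t\<^sup>2 \<cdot> (ea * ec)) = - ((1 / t\<^sup>2) \<cdot> \<sigma> Gd Gc)"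
    "\<S> (ed * eb - t\<^sup>2 \<cdot> (eb * ed)) = - (t\<^sup>2 \<cdot> \<sigma> Gb Ga)"
    "\<S> (ed * ec - t\<^sup>2 \<cdot> (ec * ed)) = - ((1 / t\<^sup>2) \<cdot> \<sigma> Gc Ga)"
    "\<S> (eb * ec - ec * eb) = \<sigma> Gc Gb"
    "\<S> (ed * ea - t\<^sup>2 \<cdot> (eb * ec) - 1) = \<sigma> Gd Ga - t\<^sup>2 \<cdot> \<sigma> Gc Gb"
    by (rule poly_mapping_eqI, (simp add: straight_def S_simps multiply_out t0; simp add: compare_coeffs;
      simp add: eval_nat_numeral field_simps t0))+
  moreover have "\<S> (ed * ea - ea * ed - qlam (t\<^sup>2) \<cdot> (eb * ec))
      = \<sigma> Gd Ga - \<sigma> Ga Gd - qlam (t\<^sup>2) \<cdot> \<sigma> Gc Gb"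
    unfolding qlam_def
    by (rule poly_mapping_eqI) (simp add: straight_def S_simps multiply_out t0; simp add: compare_coeffs;
      simp add: eval_nat_numeral field_simps t0)
  ultimately show ?thesis
    using assms unfolding rels_SU_def
    by (elim insertE emptyE; simp only:; fast intro: rel_ideal_closed straight_in_ideal)
qed

lemma antipode_rels_cross:
  assumes "r \<in> rels_cross (t\<^sup>2)"
  shows "\<S> r \<in> \<I>"
proof -
  have "\<S> (\<sigma> Ga GE) = t\<^sup>2 \<cdot> (\<sigma> Gd GE * eKi) + eE * \<sigma> Gd GKi + t \<cdot> (eK * \<sigma> Gb GKi)
      + t ^ 5 \<cdot> (\<sigma> GK GKi * eb)"
    "\<S> (\<sigma> Gb GE) = - (\<sigma> Gb GE * eKi) - (1 / t\<^sup>2) \<cdot> (eE * \<sigma> Gb GKi)"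
    "\<S> (\<sigma> Gc GE) = - (\<sigma> Gc GE * eKi) - t\<^sup>2 \<cdot> (eE * \<sigma> Gc GKi) - t ^ 3 \<cdot> (eK * \<sigma> Ga GKi)
      - t ^ 3 \<cdot> (\<sigma> GK GKi * ea)"
    "\<S> (\<sigma> Gd GE) = (1 / t\<^sup>2) \<cdot> (\<sigma> Ga GE * eKi) + eE * \<sigma> Ga GKi"
    by (rule poly_mapping_eqI, (simp add: straight_def S_simps multiply_out t0; simp add: compare_coeffs;
      simp add: eval_nat_numeral field_simps t0))+
  moreover have
    "\<S> (\<sigma> Ga GF) = t\<^sup>2 \<cdot> (\<sigma> Gd GK * eF) + t\<^sup>2 \<cdot> (eK * \<sigma> Gd GF) - (1 / t ^ 3) \<cdot> (\<sigma> GK GKi * ec)"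
    "\<S> (\<sigma> Gb GF) = - (t ^ 4 \<cdot> (\<sigma> Gb GK * eF)) - eK * \<sigma> Gb GF + (1 / t) \<cdot> (\<sigma> GK GKi * ea)
      + (1 / t) \<cdot> \<sigma> Gd GK"
    "\<S> (\<sigma> Gc GF) = - ((1 / t ^ 4) \<cdot> (\<sigma> Gc GK * eF)) - eK * \<sigma> Gc GF"
    "\<S> (\<sigma> Gd GF) = (1 / t\<^sup>2) \<cdot> (\<sigma> Ga GK * eF) + (1 / t\<^sup>2) \<cdot> (eK * \<sigma> Ga GF)
      - (1 / t ^ 7) \<cdot> \<sigma> Gc GK"
    by (rule poly_mapping_eqI, (simp add: straight_def S_simps multiply_out t0; simp add: compare_coeffs;
      simp add: eval_nat_numeral field_simps t0))+
  moreover have "\<S> (\<sigma> Ga GK) = - \<sigma> Gd GKi" "\<S> (\<sigma> Gb GK) = (1 / t\<^sup>2) \<cdot> \<sigma> Gb GKi"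
    "\<S> (\<sigma> Gc GK) = t\<^sup>2 \<cdot> \<sigma> Gc GKi" "\<S> (\<sigma> Gd GK) = - \<sigma> Ga GKi"
    by (rule poly_mapping_eqI, (simp add: straight_def S_simps multiply_out t0; simp add: compare_coeffs;
      simp add: eval_nat_numeral field_simps t0))+
  ultimately have "\<S> (\<sigma> x y) \<in> \<I>" if "x \<in> {Ga, Gb, Gc, Gd}" "y \<in> {GE, GF, GK}" for x y
    using that
    by (elim insertE emptyE; simp only:; fast intro: rel_ideal_closed straight_in_ideal)
  moreover have "\<exists>x\<in>{Ga, Gb, Gc, Gd}. \<exists>y\<in>{GE, GF, GK}. r = \<sigma> x y"
    using assms unfolding rels_cross_def powers
    by (simp add: straight_def) blast
  ultimately show ?thesis
    by blast
qed

end

text \<open>It would not suffice to know the antipode on generators: \<^const>\<open>antipode\<close> is defined on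
  cosets, and only compatibility with all relations of the q-Lorentz algebra, those of the
  \<open>a, b, c, d\<close> included, gives it a value even on the classes of \<open>E\<close>, \<open>F\<close> and \<open>K\<close>.\<close>

lemma antipode_cls:
  assumes "q > 1"
  shows "antipode q (clsH q x) = clsH q (anti_lift scal (antipode_gen q) x)"
proof -
  interpret central_scalars scal by (rule central_scal)
  have t: "sqrt q > 1" and q: "(sqrt q)\<^sup>2 = q"
    using assms by simp_all
  have "anti_lift scal (antipode_gen q) r \<in> rel_ideal (rels_H q)" if "r \<in> rels_H q" for r
    using that antipode_rels_U[OF t] antipode_rels_SU[OF t] antipode_rels_cross[OF t] unfolding q rels_H_def by blast
  then have "anti_lift scal (antipode_gen q) y \<in> rel_ideal (rels_H q)"
    if "y \<in> rel_ideal (rels_H q)" for y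
    using that by (rule rel_ideal_anti_lift)
  then show ?thesis
    unfolding antipode_def
    by (intro induced_cls) (simp add: cls_eq_iff flip: anti_lift_basic(2))
qed

section \<open>Evaluating the Pauli-Lubanski vector at rest\<close>

lemma inclH_cls: "inclH q (clsH q h) = clsA q (freeH h)"
proof -
  interpret central_scalars scal by (rule central_scal)
  have "freeH r \<in> rel_ideal (rels_A q)" if "r \<in> rels_H q" for r
    using that by (simp add: rel_ideal_incl rels_A_def)
  then have "freeH y \<in> rel_ideal (rels_A q)" if "y \<in> rel_ideal (rels_H q)" for y
    using that unfolding freeH_def by (rule rel_ideal_lift)
  then show ?thesis
    unfolding inclH_def
    by (intro induced_cls) (simp add: cls_eq_iff freeH_def flip: lift_basic(2))
qed

lemma inclX_cls: "inclX q (clsX q x) = clsA q (freeX x)"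
proof -
  interpret central_scalars scal by (rule central_scal)
  have "freeX r \<in> rel_ideal (rels_A q)" if "r \<in> rels_X q" for r
    using that by (simp add: rel_ideal_incl rels_A_def)
  then have "freeX y \<in> rel_ideal (rels_A q)" if "y \<in> rel_ideal (rels_X q)" for y
    using that unfolding freeX_def by (rule rel_ideal_lift)
  then show ?thesis
    unfolding inclX_def
    by (intro induced_cls) (simp add: cls_eq_iff freeX_def flip: lift_basic(2))
qed

lemma chi_cls: "chi (rest_momentum m) (clsX q x) = lift id (rest_momentum m) x"
proof -
  interpret central_scalars "id :: complex \<Rightarrow> complex" by (rule central_id)
  have "rel_ideal (rels_X q) \<subseteq> {x. lift id (rest_momentum m) x = 0}"
    by (rule rel_ideal_least)
      (auto simp: rels_X_def lift_basic lift_add lift_mult rest_momentum_def)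
  then show ?thesis
    unfolding chi_def by (intro induced_cls) (auto simp: lift_basic)
qed

lemma finsum_presented:
  assumes "finite A"
  shows "(\<Oplus>\<^bsub>presented R\<^esub>\<mu>\<in>A. cls R (f \<mu>)) = cls R (sum f A)"
proof -
  interpret ring "presented R" by (rule ring_presented)
  show ?thesis
    using assms by (induction A rule: finite_induct) (simp_all add: presented_simps)
qed

definition antipode_sq :: "real \<Rightarrow> lgen ncpoly \<Rightarrow> lgen ncpoly" where
  "antipode_sq q x = anti_lift scal (antipode_gen q) (anti_lift scal (antipode_gen q) x)"

lemma PL_eq_cls:
  assumes "q > 1"
  shows "PL q \<nu> = clsA q (scal (complex_of_real (1 / qlam q)) *
    (\<Sum>\<mu>\<in>UNIV. freeH (antipode_sq q (L_minus q \<mu> \<nu> - L_plus q \<mu> \<nu>)) * freeX (gen \<mu>)))"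
  unfolding PL_def PA_def
  by (simp only: antipode_cls[OF assms] inclH_cls inclX_cls presented_simps finsum_presented
      finite antipode_sq_def)

lemma sum_idx: "sum f (UNIV :: idx set) = f I0 + f IM + f IP + (f I3 :: 'a::comm_monoid_add)"
proof -
  have UNIV_idx: "(UNIV :: idx set) = {I0, IM, IP, I3}"
    using idx.exhaust by auto
  show ?thesis unfolding UNIV_idx by (simp add: add.assoc)
qed

text \<open>At \<open>\<chi>(P\<^sub>\<mu>) = m \<delta>\<^sub>\<mu>\<^sub>0\<close> only row \<open>0\<close> of \<open>L\<^sub>- - L\<^sub>+\<close> survives.  The vector is already written
  in the order \<open>\<Sum>\<^sub>i h\<^sub>i x\<^sub>i\<close> on which \<open>f\<close> is prescribed, so \<open>f\<close> can be applied term by term.\<close>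

lemma chi_hat_PL:
  assumes q: "q > 1" and f: "is_chi_hat q (rest_momentum m) f"
  shows "f (PL q \<nu>) = clsH q ((m / qlam q) \<cdot> antipode_sq q (L_minus q I0 \<nu> - L_plus q I0 \<nu>))"
proof -
  define a where "a \<mu> = antipode_sq q (L_minus q \<mu> \<nu> - L_plus q \<mu> \<nu>)" for \<mu>
  have f_add: "f (clsA q (x + y)) = f (clsA q x) \<oplus>\<^bsub>HA q\<^esub> f (clsA q y)"
    and f_scal: "f (clsA q (scal c * x)) = clsH q (scal c) \<otimes>\<^bsub>HA q\<^esub> f (clsA q x)" for x y c
    using f unfolding is_chi_hat_def PA_def
    by (simp_all add: presented_simps flip: presented_simps(1,2))
  have "f (clsA q (freeH h * freeX x)) = clsH q (h * scal (chi (rest_momentum m) (clsX q x)))" for h x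
    using f unfolding is_chi_hat_def PA_def HA_def XA_def
    by (simp add: presented_simps inclH_cls inclX_cls)
  then have f_prod: "f (clsA q (freeH h * freeX (gen \<mu>))) = clsH q (h * scal (rest_momentum m \<mu>))" for h \<mu>
    by (simp add: chi_cls central_scalars.lift_basic[OF central_id])
  have "f (PL q \<nu>) = clsH q (scal (complex_of_real (1 / qlam q)) * (\<Sum>\<mu>\<in>UNIV. a \<mu> * scal (rest_momentum m \<mu>)))"
    unfolding PL_eq_cls[OF q] f_scal sum_idx f_add f_prod
    by (simp only: HA_def presented_simps a_def)
  also have "(\<Sum>\<mu>\<in>UNIV. a \<mu> * scal (rest_momentum m \<mu>)) = m \<cdot> a I0"
    using central_scalars.s_central[OF central_scal, of "complex_of_real m" "a I0"]
    by (simp add: sum_idx rest_momentum_def rscale_def central_scalars.s_zero[OF central_scal])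
  also have "scal (complex_of_real (1 / qlam q)) * (m \<cdot> a I0) = (m / qlam q) \<cdot> a I0"
    unfolding rscale_def[symmetric] by (simp add: rscale_rscale)
  finally show ?thesis by (simp add: a_def)
qed

lemma qlam_pos: "q > 1 \<Longrightarrow> qlam q > 0"
  by (simp add: qlam_def) (smt (verit) divide_less_eq_1_pos)

lemma qnum_2_pos: "q > 1 \<Longrightarrow> qnum q 2 > 0"
  using qlam_pos[of q] power_strict_mono[of "1 / q" q 2] unfolding qnum_def qlam_def
  by (intro divide_pos_pos) simp_all

lemma L_row:
  "L_minus q I0 I0 - L_plus q I0 I0 = W_cas q - 1"
  "L_minus q I0 IM - L_plus q I0 IM = qlam q \<cdot> (eKi * J_minus q)"
  "L_minus q I0 IP - L_plus q I0 IP = qlam q \<cdot> (eKi * J_plus q)"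
  "L_minus q I0 I3 - L_plus q I0 I3 = W_cas q - eKi"
  by (simp_all add: L_minus_def L_plus_def mat_def Let_def)

text \<open>The square of the antipode is an algebra homomorphism, which on \<open>U\<^sub>q(su\<^sub>2)\<close> is conjugation
  by \<open>K\<close>.\<close>

lemma antipode_sq_simps:
  "antipode_sq q (x + y) = antipode_sq q x + antipode_sq q y"
  "antipode_sq q (x - y) = antipode_sq q x - antipode_sq q y"
  "antipode_sq q (x * y) = antipode_sq q x * antipode_sq q y"
  "antipode_sq q (r \<cdot> x) = r \<cdot> antipode_sq q x"
  "antipode_sq q 1 = 1"
  "antipode_sq q eE = eK * eE * eKi" "antipode_sq q eF = eK * eF * eKi"
  "antipode_sq q eK = eK" "antipode_sq q eKi = eKi"
proof -
  interpret central_scalars scal by (rule central_scal)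
  show "antipode_sq q (x + y) = antipode_sq q x + antipode_sq q y"
    "antipode_sq q (x - y) = antipode_sq q x - antipode_sq q y"
    "antipode_sq q (x * y) = antipode_sq q x * antipode_sq q y"
    "antipode_sq q (r \<cdot> x) = r \<cdot> antipode_sq q x"
    "antipode_sq q 1 = 1"
    "antipode_sq q eE = eK * eE * eKi" "antipode_sq q eF = eK * eF * eKi"
    "antipode_sq q eK = eK" "antipode_sq q eKi = eKi"
    by (simp_all add: antipode_sq_def anti_lift_rscale anti_lift_basic(1-5) anti_lift_add anti_lift_mult mult.assoc)
qed

lemma KK_rel: "eKi * eK - 1 \<in> rel_ideal (rels_H q)"
  by (simp add: rel_ideal_incl rels_H_def rels_U_def)

text \<open>Each summand of \<open>W\<close> has weight \<open>0\<close>, that is, the factors \<open>q\<^sup>2\<close> and \<open>q\<^sup>-\<^sup>2\<close> by which conjugation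
  with \<open>K\<close> rescales \<open>E\<close> and \<open>F\<close> cancel.\<close>

lemma antipode_sq_W:
  assumes "q > 1"
  shows "antipode_sq q (W_cas q) - W_cas q \<in> rel_ideal (rels_H q)"
proof -
  have E: "eK * eE * eKi - q\<^sup>2 \<cdot> eE \<in> rel_ideal (rels_H q)" (is "?e \<in> _")
    and F: "eK * eF * eKi - (1 / q\<^sup>2) \<cdot> eF \<in> rel_ideal (rels_H q)" (is "?f \<in> _")
    by (simp_all add: rel_ideal_incl rels_H_def rels_U_def)
  have "antipode_sq q (eE * eF) - eE * eF = ?e * (eK * eF * eKi) + q\<^sup>2 \<cdot> (eE * ?f)"
    "antipode_sq q (eF * eE) - eF * eE = ?f * (eK * eE * eKi) + (1 / q\<^sup>2) \<cdot> (eF * ?e)"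
    using assms by (simp_all add: antipode_sq_simps algebra_simps rscale_rules rscale_rscale rscale_one)
  then have EF: "antipode_sq q (eE * eF) - eE * eF \<in> rel_ideal (rels_H q)"
    "antipode_sq q (eF * eE) - eF * eE \<in> rel_ideal (rels_H q)"
    using E F by (fastforce intro: rel_ideal_closed)+
  have "antipode_sq q (W_cas q) - W_cas q = - (qlam q \<cdot> (1 / qnum q 2) \<cdot>
      ((1 / q) \<cdot> (antipode_sq q (eE * eF) - eE * eF) - q \<cdot> (antipode_sq q (eF * eE) - eF * eE)))"
    by (simp add: W_cas_def J_three_def antipode_sq_simps rscale_rules algebra_simps)
  with EF show ?thesis
    by (simp add: rel_ideal_closed)
qed

text \<open>The components \<open>\<mp>\<close> are \<open>m S\<^sup>2(K\<^sup>-\<^sup>1 J\<^sub>\<mp>) = m J\<^sub>\<mp> K\<^sup>-\<^sup>1\<close>: conjugation by \<open>K\<close> moves \<open>K\<^sup>-\<^sup>1\<close> from the left to the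
  right of \<open>J\<^sub>\<mp>\<close>.\<close>

lemma chi_hat_values:
  assumes q: "q > 1" and f: "is_chi_hat q (rest_momentum m) f"
  shows "f (PL q I0) = clsH q ((m / qlam q) \<cdot> (W_cas q - 1))"
    "f (PL q IM) = clsH q (m \<cdot> (J_minus q * eKi))"
    "f (PL q IP) = clsH q (m \<cdot> (J_plus q * eKi))"
    "f (PL q I3) = clsH q ((m / qlam q) \<cdot> (W_cas q - eKi))"
proof -
  have l: "qlam q \<noteq> 0"
    using qlam_pos[OF q] by simp
  have "(m / qlam q) \<cdot> antipode_sq q (W_cas q - z) - (m / qlam q) \<cdot> (W_cas q - z)
      = (m / qlam q) \<cdot> (antipode_sq q (W_cas q) - W_cas q)" if "antipode_sq q z = z" for z
    by (simp add: antipode_sq_simps that rscale_rules)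
  then show "f (PL q I0) = clsH q ((m / qlam q) \<cdot> (W_cas q - 1))"
    "f (PL q I3) = clsH q ((m / qlam q) \<cdot> (W_cas q - eKi))"
    by (simp_all add: chi_hat_PL[OF q f] L_row cls_eq_iff antipode_sq_W[OF q] rel_ideal_rscale antipode_sq_simps)
  have "(m / qlam q) \<cdot> antipode_sq q (qlam q \<cdot> (eKi * J_minus q)) - m \<cdot> (J_minus q * eKi)
      = (m * (q / sqrt (qnum q 2))) \<cdot> ((eKi * eK - 1) * eK * eF * eKi)"
    using l by (simp add: J_minus_def antipode_sq_simps rscale_rules rscale_rscale algebra_simps)
  then show "f (PL q IM) = clsH q (m \<cdot> (J_minus q * eKi))"
    by (simp add: chi_hat_PL[OF q f] L_row cls_eq_iff rel_ideal_closed KK_rel)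
  have "(m / qlam q) \<cdot> antipode_sq q (qlam q \<cdot> (eKi * J_plus q)) - m \<cdot> (J_plus q * eKi)
      = (m * (- 1 / sqrt (qnum q 2))) \<cdot> ((eKi * eK - 1) * eE * eKi)"
    using l by (simp add: J_plus_def antipode_sq_simps rscale_rules rscale_rscale algebra_simps)
  then show "f (PL q IP) = clsH q (m \<cdot> (J_plus q * eKi))"
    by (simp add: chi_hat_PL[OF q f] L_row cls_eq_iff rel_ideal_closed KK_rel)
qed

section \<open>The little algebra\<close>

lemma subalg_closed:
  "clsH q (scal c) \<in> subalg q G" "clsH q 1 \<in> subalg q G"
  "clsH q x \<in> subalg q G \<Longrightarrow> clsH q y \<in> subalg q G \<Longrightarrow> clsH q (x + y) \<in> subalg q G"
  "clsH q x \<in> subalg q G \<Longrightarrow> clsH q y \<in> subalg q G \<Longrightarrow> clsH q (x * y) \<in> subalg q G"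
  "clsH q x \<in> subalg q G \<Longrightarrow> clsH q (r \<cdot> x) \<in> subalg q G"
  "clsH q x \<in> subalg q G \<Longrightarrow> clsH q y \<in> subalg q G \<Longrightarrow> clsH q (x - y) \<in> subalg q G"
proof -
  show scal: "clsH q (scal c) \<in> subalg q G" for c
    unfolding subalg_def by (rule generate_ring.incl) blast
  show "clsH q 1 \<in> subalg q G"
    using scal[of 1] by (simp add: central_scalars.s_one[OF central_scal])
  show mult: "clsH q (x * y) \<in> subalg q G" if "clsH q x \<in> subalg q G" "clsH q y \<in> subalg q G" for x y
    using that generate_ring.eng_mult unfolding subalg_def HA_def
    by (fastforce simp flip: presented_simps)
  show add: "clsH q (x + y) \<in> subalg q G" if "clsH q x \<in> subalg q G" "clsH q y \<in> subalg q G" for x y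
    using that generate_ring.eng_add unfolding subalg_def HA_def
    by (fastforce simp flip: presented_simps)
  show scale: "clsH q (r \<cdot> x) \<in> subalg q G" if "clsH q x \<in> subalg q G" for r x
    unfolding rscale_def by (rule mult[OF scal that])
  have "x - y = x + (- 1) \<cdot> y"
    by (simp add: rscale_def scal_def single_uminus)
  then show "clsH q (x - y) \<in> subalg q G" if "clsH q x \<in> subalg q G" "clsH q y \<in> subalg q G"
    using add[OF that(1) scale[OF that(2), of "- 1"]] by metis
qed

lemma subalg_gen: "g \<in> G \<Longrightarrow> g \<in> subalg q G"
  unfolding subalg_def by (rule generate_ring.incl) blast

lemma subalg_least:
  assumes "G \<subseteq> subalg q G'"
  shows "subalg q G \<subseteq> subalg q G'"
proof
  fix x assume "x \<in> subalg q G"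
  then show "x \<in> subalg q G'"
    unfolding subalg_def
  proof induction
    case (incl h)
    then show ?case
      using assms unfolding subalg_def by (auto intro: generate_ring.incl)
  qed (auto intro: generate_ring.intros)
qed

theorem mainTheorem3:
  fixes q m :: real
    and chi_hat :: "(lgen + idx) ncpoly set \<Rightarrow> lgen ncpoly set"
  assumes "q > 1" and "m > 0"
    and "is_chi_hat q (rest_momentum m) chi_hat"
  shows "chi_hat (PL q I0) = clsH q ((m / qlam q) \<cdot> (W_cas q - 1))
    \<and> chi_hat (PL q IM) = clsH q (m \<cdot> (J_minus q * eKi))
    \<and> chi_hat (PL q IP) = clsH q (m \<cdot> (J_plus q * eKi))
    \<and> chi_hat (PL q I3) = clsH q ((m / qlam q) \<cdot> (W_cas q - eKi))
    \<and> massive_little_alg q chi_hat = Uq_su2 q"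
proof -
  note PL_values = chi_hat_values[OF assms(1,3)]
  have l: "qlam q \<noteq> 0" and n: "qnum q 2 > 0"
    using qlam_pos qnum_2_pos assms(1) by force+
  define G where "G = range (\<lambda>\<mu>. chi_hat (PL q \<mu>)) \<union> {clsH q eK}"
  define U where "U = {clsH q eE, clsH q eF, clsH q eK, clsH q eKi}"
  have U: "clsH q eE \<in> subalg q U" "clsH q eF \<in> subalg q U" "clsH q eK \<in> subalg q U"
      "clsH q eKi \<in> subalg q U"
    by (simp_all add: U_def subalg_gen)
  have "chi_hat (PL q \<mu>) \<in> subalg q U" for \<mu>
    by (cases \<mu>) (simp_all only: PL_values W_cas_def J_minus_def J_plus_def J_three_def subalg_closed U)
  then have "G \<subseteq> subalg q U"
    using U by (auto simp: G_def)
  then have le: "subalg q G \<subseteq> subalg q U" by (rule subalg_least)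
  have PL: "chi_hat (PL q \<mu>) \<in> subalg q G" and K: "clsH q eK \<in> subalg q G" for \<mu>
    by (simp_all add: G_def subalg_gen)
  note PL = PL[of I0, unfolded PL_values] PL[of IM, unfolded PL_values]
    PL[of IP, unfolded PL_values] PL[of I3, unfolded PL_values]
  \<comment> \<open>The difference of the components \<open>0\<close> and \<open>3\<close> is a multiple of \<open>K\<^sup>-\<^sup>1 - 1\<close>; with \<open>K\<close> and \<open>K\<^sup>-\<^sup>1\<close>
    available, \<open>E\<close> and \<open>F\<close> are read off from the components \<open>+\<close> and \<open>-\<close>.\<close>
  have "eKi = (qlam q / m) \<cdot> ((m / qlam q) \<cdot> (W_cas q - 1) - (m / qlam q) \<cdot> (W_cas q - eKi)) + 1"
    using l assms(2) by (simp add: rscale_rules rscale_rscale rscale_one)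
  then have Ki: "clsH q eKi \<in> subalg q G"
    by (metis PL(1,4) subalg_closed(2,3,5,6))
  have "eE - (- sqrt (qnum q 2) / m) \<cdot> (m \<cdot> (J_plus q * eKi) * eK) = - (eE * (eKi * eK - 1))"
    using n assms(2) by (simp add: J_plus_def rscale_rules rscale_rscale rscale_one algebra_simps)
  then have "clsH q eE = clsH q ((- sqrt (qnum q 2) / m) \<cdot> (m \<cdot> (J_plus q * eKi) * eK))"
    by (simp add: cls_eq_iff rel_ideal_closed KK_rel)
  then have E: "clsH q eE \<in> subalg q G"
    by (simp only: subalg_closed PL K)
  have "eF - (sqrt (qnum q 2) / (m * q)) \<cdot> (eKi * (m \<cdot> (J_minus q * eKi)) * eK)
      = - ((eKi * eK - 1) * eF * eKi * eK + eF * (eKi * eK - 1))"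
    using n assms(1,2) by (simp add: J_minus_def rscale_rules rscale_rscale rscale_one algebra_simps)
  then have "clsH q eF = clsH q ((sqrt (qnum q 2) / (m * q)) \<cdot> (eKi * (m \<cdot> (J_minus q * eKi)) * eK))"
    by (simp add: cls_eq_iff rel_ideal_closed KK_rel del: minus_add_distrib)
  then have F: "clsH q eF \<in> subalg q G"
    by (simp only: subalg_closed PL K Ki)
  have "subalg q U \<subseteq> subalg q G"
    using E F K Ki by (intro subalg_least) (auto simp: U_def)
  with le have "massive_little_alg q chi_hat = Uq_su2 q"
    by (simp add: massive_little_alg_def Uq_su2_def G_def U_def)
  then show ?thesis
    by (simp add: PL_values)
qed

end
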